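(* Let $x,y\in\mathbb{R}$ and let $n\ge 0$ and $N\ge 1$ be integers. Then the Quasi-Hermite polynomials $H_n(x,y;N)$ satisfy: a) $H_n(x,y;N)=\displaystyle\sum_{r=0}^{\min\left[N,\lfloor n/2\rfloor\right]}\binom{N}{r}\left(\frac{y}{N}\right)^r\frac{n!}{(n-2r)!}\,x^{n-2r}$; b) $\left(x+\dfrac{2y\,\partial_x}{1+\frac{y}{N}\partial_x^2}\right)\partial_x H_n(x,y;N)=n\,H_n(x,y;N)$.
   Context: For an integer $N\ge 1$, real $y$ and integer $n\ge 0$, the Quasi-Hermite polynomial is defined by $H_n(x,y;N)=\left(1+\frac{y}{N}\partial_x^2\right)^N x^n$, where $\partial_x$ is differentiation with respect to $x$. The symbol $x$ inside an operator denotes multiplication by $x$. The operator $\frac{1}{1+\frac{y}{N}\partial_x^2}$ denotes the inverse of $1+\frac{y}{N}\partial_x^2$ on polynomials in $x$, i.e. $\sum_{k\ge 0}\left(-\frac{y}{N}\right)^k\partial_x^{2k}$ (a finite sum on each polynomial), and $\frac{2y\,\partial_x}{1+\frac{y}{N}\partial_x^2}=2y\,\partial_x\cdot\frac{1}{1+\frac{y}{N}\partial_x^2}$ (the two factors commute). *)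

theory Defs
  imports Complex_Main "HOL-Computational_Algebra.Polynomial" "HOL-Library.Groups_Big_Fun"
begin

text \<open>
  Throughout, \<open>x\<close> is the polynomial indeterminate, \<^const>\<open>pderiv\<close> is \<open>\<partial>\<^sub>x\<close>, and the operators
  act on real polynomials: \<open>base_op y N\<close> is \<open>1 + (y/N) \<partial>\<^sub>x\<^sup>2\<close>, and
  \<open>raising_op y N\<close> is \<open>x + 2y \<partial>\<^sub>x / (1 + (y/N) \<partial>\<^sub>x\<^sup>2)\<close>.
\<close>

definition base_op :: "real \<Rightarrow> nat \<Rightarrow> real poly \<Rightarrow> real poly" where
  "base_op y N p = p + smult (y / real N) ((pderiv ^^ 2) p)"

definition quasi_hermite :: "nat \<Rightarrow> real \<Rightarrow> nat \<Rightarrow> real poly" where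
  "quasi_hermite n y N = (base_op y N ^^ N) (monom 1 n)"

text \<open>
  The inverse of \<^const>\<open>base_op\<close>, given by its Neumann series. Only finitely many
  summands are nonzero (lemma \<open>finite_inv_base_op_support\<close>), so \<^const>\<open>Sum_any\<close> is the
  genuine sum over all \<open>k \<ge> 0\<close>; lemma \<open>inv_base_op_eq_inv\<close> shows that it is the inverse map.
\<close>

definition inv_base_op :: "real \<Rightarrow> nat \<Rightarrow> real poly \<Rightarrow> real poly" where
  "inv_base_op y N p = Sum_any (\<lambda>k. smult ((- (y / real N)) ^ k) ((pderiv ^^ (2 * k)) p))"

definition mult_x :: "real poly \<Rightarrow> real poly" where
  "mult_x p = [:0, 1:] * p"

definition raising_op :: "real \<Rightarrow> nat \<Rightarrow> real poly \<Rightarrow> real poly" where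
  "raising_op y N p = mult_x p + smult (2 * y) (pderiv (inv_base_op y N p))"

lemma pderiv_funpow_eq_0:
  fixes p :: "real poly"
  assumes "degree p < m"
  shows "(pderiv ^^ m) p = 0"
  using assms
proof (induction m arbitrary: p)
  case (Suc m)
  show ?case
  proof (cases "degree p = 0")
    case True
    then have "pderiv p = 0" by (simp add: pderiv_eq_0_iff)
    moreover have "(pderiv ^^ m) (0 :: real poly) = 0" by (induction m) auto
    ultimately show ?thesis by (simp add: funpow_Suc_right del: funpow.simps)
  next
    case False
    then have "degree (pderiv p) < m" using Suc.prems by (simp add: degree_pderiv)
    then show ?thesis using Suc.IH by (simp add: funpow_Suc_right del: funpow.simps)
  qed
qed simp

lemma finite_inv_base_op_support:
  "finite {k. smult ((- (y / real N)) ^ k) ((pderiv ^^ (2 * k)) p) \<noteq> 0}"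
proof (rule finite_subset)
  show "{k. smult ((- (y / real N)) ^ k) ((pderiv ^^ (2 * k)) p) \<noteq> 0} \<subseteq> {..degree p}"
  proof
    fix k assume "k \<in> {k. smult ((- (y / real N)) ^ k) ((pderiv ^^ (2 * k)) p) \<noteq> 0}"
    then have "(pderiv ^^ (2 * k)) p \<noteq> 0" by auto
    then have "\<not> degree p < 2 * k" using pderiv_funpow_eq_0 by blast
    then show "k \<in> {..degree p}" by simp
  qed
qed simp

lemma inv_base_op_eq_sum:
  assumes "degree p < 2 * m"
  shows "inv_base_op y N p = (\<Sum>k<m. smult ((- (y / real N)) ^ k) ((pderiv ^^ (2 * k)) p))"
  unfolding inv_base_op_def
proof (rule Sum_any.expand_superset)
  show "{k. smult ((- (y / real N)) ^ k) ((pderiv ^^ (2 * k)) p) \<noteq> 0} \<subseteq> {..<m}"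
  proof
    fix k assume "k \<in> {k. smult ((- (y / real N)) ^ k) ((pderiv ^^ (2 * k)) p) \<noteq> 0}"
    then have "(pderiv ^^ (2 * k)) p \<noteq> 0" by auto
    then have "\<not> degree p < 2 * k" using pderiv_funpow_eq_0 by blast
    then show "k \<in> {..<m}" using assms by simp
  qed
qed simp

lemma pderiv_funpow_add:
  "(pderiv ^^ m) (p + q :: real poly) = (pderiv ^^ m) p + (pderiv ^^ m) q"
  by (induction m) (auto simp: pderiv_add)

lemma pderiv_funpow_smult:
  "(pderiv ^^ m) (smult c p :: real poly) = smult c ((pderiv ^^ m) p)"
  by (induction m) (auto simp: pderiv_smult)

lemma smult_sum_lessThan:
  "smult c (\<Sum>k<(j::nat). f k) = (\<Sum>k<j. smult c (f k :: real poly))"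
  by (induction j) (auto simp: smult_add_right)

lemma pderiv_funpow_sum:
  "(pderiv ^^ m) (\<Sum>k<(j::nat). f k :: real poly) = (\<Sum>k<j. (pderiv ^^ m) (f k))"
proof (induction j)
  case 0
  show ?case using pderiv_funpow_smult[of m 0 0] by simp
qed (simp add: pderiv_funpow_add)

lemma base_op_partial_sum:
  "(\<Sum>k<m. smult ((- c) ^ k) ((pderiv ^^ (2 * k)) p)) +
   smult c (\<Sum>k<m. smult ((- c) ^ k) ((pderiv ^^ (2 * k + 2)) p)) =
   p - smult ((- c) ^ m) ((pderiv ^^ (2 * m)) (p :: real poly))"
proof (induction m)
  case (Suc m)
  then show ?case by (simp add: smult_add_right algebra_simps)
qed simp

lemma base_op_inv_base_op: "base_op y N (inv_base_op y N p) = p"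
proof -
  define m where "m = Suc (degree p)"
  have m: "degree p < 2 * m" by (simp add: m_def)
  have z: "(pderiv ^^ (2 * m)) p = 0" using m by (rule pderiv_funpow_eq_0)
  show ?thesis
    using base_op_partial_sum[of "y / real N" p m]
    unfolding base_op_def inv_base_op_eq_sum[OF m] pderiv_funpow_sum pderiv_funpow_smult z
    by (simp add: funpow_add numeral_2_eq_2 funpow_swap1)
qed

lemma inv_base_op_base_op: "inv_base_op y N (base_op y N p) = p"
proof -
  define m where "m = Suc (degree p + degree (base_op y N p))"
  have m: "degree (base_op y N p) < 2 * m" by (simp add: m_def)
  have z: "(pderiv ^^ (2 * m)) p = 0"
    by (rule pderiv_funpow_eq_0) (simp add: m_def)
  have e: "(pderiv ^^ (2 * k)) ((pderiv ^^ 2) p) = (pderiv ^^ (2 * k + 2)) p" for k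
    by (simp only: funpow_add comp_apply)
  show ?thesis
    using base_op_partial_sum[of "y / real N" p m]
    unfolding inv_base_op_eq_sum[OF m] z
    unfolding base_op_def pderiv_funpow_add pderiv_funpow_smult e
    by (simp add: smult_add_right sum.distrib smult_sum_lessThan mult.commute del: funpow.simps)
qed

lemma inv_base_op_eq_inv: "inv_base_op y N = inv (base_op y N)"
  using base_op_inv_base_op inv_base_op_base_op by (metis inv_equality ext)

lemma pderiv_inv_base_op: "pderiv (inv_base_op y N p) = inv_base_op y N (pderiv p)"
proof -
  have c: "base_op y N (pderiv q) = pderiv (base_op y N q)" for q
    by (simp add: base_op_def pderiv_add pderiv_smult numeral_2_eq_2)
  show ?thesis by (metis c base_op_inv_base_op inv_base_op_base_op)
qed

end

theory Submission
  imports Defs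
begin

text \<open>
  Part (a) is the binomial expansion of the operator power. For part (b), let
  \<open>B = 1 + c \<partial>\<^sub>x\<^sup>2\<close> with \<open>c = y/N\<close>. Leibniz' rule gives
  \<open>B\<^sup>N x = x B\<^sup>N + 2 c N \<partial>\<^sub>x B\<^bsup>N-1\<^esup>\<close>. Since \<open>B\<close> commutes with \<open>\<partial>\<^sub>x\<close> and
  \<open>B\<^bsup>N-1\<^esup> = B\<^bsup>-1\<^esup> B\<^sup>N\<close>, applying this to \<open>\<partial>\<^sub>x x\<^sup>n\<close> turns \<open>x \<partial>\<^sub>x x\<^sup>n = n x\<^sup>n\<close> into the claim.
\<close>

lemma base_op_add: "base_op y N (p + q) = base_op y N p + base_op y N q"
  by (simp add: base_op_def pderiv_funpow_add smult_add_right)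

lemma base_op_smult: "base_op y N (smult a p) = smult a (base_op y N p)"
  by (simp add: base_op_def pderiv_funpow_smult smult_add_right mult.commute)

lemma pderiv_base_op: "pderiv (base_op y N p) = base_op y N (pderiv p)"
  by (simp add: base_op_def pderiv_add pderiv_smult numeral_2_eq_2)

lemma funpow_base_op_smult: "(base_op y N ^^ m) (smult a p) = smult a ((base_op y N ^^ m) p)"
  by (induction m) (simp_all add: base_op_smult)

lemma pderiv_funpow_base_op: "pderiv ((base_op y N ^^ m) p) = (base_op y N ^^ m) (pderiv p)"
  by (induction m) (simp_all add: pderiv_base_op)

text \<open>Induction on \<open>m\<close>: one more factor \<open>base_op\<close> adds a copy of the
  sum with its index shifted by one, and Pascal's rule merges the two.\<close>

lemma funpow_base_op_eq_sum:
  "(base_op y N ^^ m) p =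
     (\<Sum>r\<le>m. smult (real (m choose r) * (y / real N) ^ r) ((pderiv ^^ (2 * r)) p))"
proof (induction m)
  case 0
  show ?case by simp
next
  case (Suc m)
  define c where "c = y / real N"
  \<comment> \<open>The scalar \<open>a\<close> is kept apart from the index \<open>r\<close>, so
    that Pascal's rule becomes additivity of \<open>t\<close> in \<open>a\<close>.\<close>
  define t where "t a r = smult (a * c ^ r) ((pderiv ^^ (2 * r)) p)" for a r
  have t_add: "t (a + b) r = t a r + t b r" for a b r
    by (simp add: t_def smult_add_left distrib_right)
  have t_Suc: "smult c ((pderiv ^^ 2) (t a r)) = t a (Suc r)" for a r
    unfolding t_def pderiv_funpow_smult by (simp add: numeral_2_eq_2 mult_ac)
  have step: "base_op y N (\<Sum>r\<le>m. t (f r) r) =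
      (\<Sum>r\<le>m. t (f r) r) + (\<Sum>r\<le>m. t (f r) (Suc r))" for f
    unfolding base_op_def c_def[symmetric] lessThan_Suc_atMost[symmetric]
      pderiv_funpow_sum smult_sum_lessThan t_Suc ..
  have "(\<Sum>r\<le>Suc m. t (real (Suc m choose r)) r) =
      t 1 0 + (\<Sum>r\<le>m. t (real (m choose Suc r)) (Suc r)) +
      (\<Sum>r\<le>m. t (real (m choose r)) (Suc r))"
    by (simp add: sum.atMost_Suc_shift t_add sum.distrib add_ac del: sum.atMost_Suc)
  also have "t 1 0 + (\<Sum>r\<le>m. t (real (m choose Suc r)) (Suc r)) =
      (\<Sum>r\<le>Suc m. t (real (m choose r)) r)"
    by (simp add: sum.atMost_Suc_shift del: sum.atMost_Suc)
  \<comment> \<open>The top term vanishes because \<open>m choose Suc m\<close> is 0.\<close>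
  also have "\<dots> = (\<Sum>r\<le>m. t (real (m choose r)) r)"
    by (simp add: t_def)
  finally show ?case
    using Suc.IH step[of "\<lambda>r. real (m choose r)"] by (simp add: t_def c_def)
qed

lemma pderiv_funpow_monom:
  "(pderiv ^^ m) (monom 1 n :: real poly) =
     (if m \<le> n then monom (fact n / fact (n - m)) (n - m) else 0)"
proof (induction m)
  case (Suc m)
  show ?case
  proof (cases "m < n")
    case True
    \<comment> \<open>This form of \<open>n\<close> removes the truncated subtractions
      \<open>n - m\<close> and \<open>n - Suc m\<close>.\<close>
    then obtain k where "n = Suc (m + k)" using less_iff_Suc_add by auto
    then show ?thesis using Suc.IH
      by (simp add: pderiv_monom field_simps Suc_diff_le del: of_nat_Suc)
  next
    case False
    then show ?thesis using Suc.IH by (auto simp: pderiv_monom)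
  qed
qed simp

text \<open>By Leibniz, the commutator of the second derivative with multiplication by the
  indeterminate is twice the first derivative.\<close>

lemma base_op_mult_x:
  "base_op y N (mult_x p) = mult_x (base_op y N p) + smult (2 * (y / real N)) (pderiv p)"
proof -
  have "(pderiv ^^ 2) (mult_x p) = mult_x ((pderiv ^^ 2) p) + smult 2 (pderiv p)"
    by (simp add: mult_x_def numeral_2_eq_2 pderiv_mult pderiv_pCons pderiv_add)
      (simp add: numeral_poly)
  then show ?thesis
    by (simp add: base_op_def mult_x_def smult_add_right algebra_simps)
qed

text \<open>Moving \<open>mult_x\<close> past each of the \<open>Suc m\<close> factors leaves one
  commutator. All of them are equal, since \<open>base_op\<close> commutes with
  \<open>pderiv\<close>.\<close>

lemma funpow_base_op_mult_x:
  "(base_op y N ^^ Suc m) (mult_x p) =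
     mult_x ((base_op y N ^^ Suc m) p) +
     smult (2 * (y / real N) * real (Suc m)) (pderiv ((base_op y N ^^ m) p))"
proof (induction m)
  case 0
  show ?case by (simp add: base_op_mult_x)
next
  case (Suc m)
  let ?c = "2 * (y / real N)"
  let ?q = "(base_op y N ^^ Suc m) p"
  have "(base_op y N ^^ Suc (Suc m)) (mult_x p) =
      base_op y N (mult_x ?q + smult (?c * real (Suc m)) (pderiv ((base_op y N ^^ m) p)))"
    using Suc.IH by simp
  also have "\<dots> = mult_x (base_op y N ?q) + smult ?c (pderiv ?q) +
      smult (?c * real (Suc m)) (pderiv ?q)"
    by (simp add: base_op_add base_op_smult base_op_mult_x pderiv_base_op)
  also have "\<dots> = mult_x (base_op y N ?q) + smult (?c * real (Suc (Suc m))) (pderiv ?q)"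
    by (simp add: add.assoc flip: smult_add_left) (simp add: add_divide_distrib algebra_simps)
  finally show ?case by simp
qed

lemma poly_quasi_hermite:
  "poly (quasi_hermite n y N) x =
     (\<Sum>r = 0..min N (n div 2). real (N choose r) * (y / real N) ^ r *
        (fact n / fact (n - 2 * r)) * x ^ (n - 2 * r))"
proof -
  have "poly (quasi_hermite n y N) x =
      (\<Sum>r\<le>N. real (N choose r) * (y / real N) ^ r *
         poly ((pderiv ^^ (2 * r)) (monom 1 n)) x)"
    by (simp add: quasi_hermite_def funpow_base_op_eq_sum poly_sum)
  \<comment> \<open>The terms with \<open>2 * r > n\<close> drop out, as the derivative of the
    monomial is then zero.\<close>
  also have "\<dots> = (\<Sum>r = 0..min N (n div 2). real (N choose r) * (y / real N) ^ r *
        (fact n / fact (n - 2 * r)) * x ^ (n - 2 * r))"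
    by (rule sum.mono_neutral_cong_right) (auto simp: pderiv_funpow_monom poly_monom)
  finally show ?thesis .
qed

lemma raising_op_pderiv_quasi_hermite:
  assumes "N \<ge> 1"
  shows "raising_op y N (pderiv (quasi_hermite n y N)) = smult (real n) (quasi_hermite n y N)"
proof -
  obtain m where N: "N = Suc m" using assms by (cases N) auto
  define p :: "real poly" where "p = pderiv (monom 1 n)"
  \<comment> \<open>For \<open>n = 0\<close> both sides are zero.\<close>
  have euler: "mult_x p = smult (real n) (monom 1 n)"
    by (cases n) (simp_all add: p_def mult_x_def pderiv_monom smult_monom flip: monom_Suc)
  have d: "pderiv (quasi_hermite n y N) = (base_op y N ^^ N) p"
    by (simp add: quasi_hermite_def p_def pderiv_funpow_base_op)
  \<comment> \<open>The inverse cancels one of the \<open>Suc m\<close> factors.\<close>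
  have i: "inv_base_op y N ((base_op y N ^^ N) p) = (base_op y N ^^ m) p"
    using inv_base_op_base_op[of y N "(base_op y N ^^ m) p"] by (simp add: N)
  \<comment> \<open>Since \<open>N\<close> is nonzero, the coefficient
    \<open>2 * (y / real N) * real N\<close> equals the \<open>2 * y\<close> of
    \<open>raising_op\<close>.\<close>
  have "raising_op y N (pderiv (quasi_hermite n y N)) = (base_op y N ^^ N) (mult_x p)"
    using funpow_base_op_mult_x[of m y N p] assms
    unfolding N[symmetric] raising_op_def d i by simp
  also have "\<dots> = smult (real n) (quasi_hermite n y N)"
    by (simp add: euler funpow_base_op_smult quasi_hermite_def)
  finally show ?thesis .
qed

theorem proposition1:
  fixes x y :: real and n N :: nat
  assumes "N \<ge> 1"
  shows "poly (quasi_hermite n y N) x =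
           (\<Sum>r = 0..min N (n div 2). real (N choose r) * (y / real N) ^ r *
              (fact n / fact (n - 2 * r)) * x ^ (n - 2 * r)) \<and>
         poly (raising_op y N (pderiv (quasi_hermite n y N))) x =
           real n * poly (quasi_hermite n y N) x"
  using poly_quasi_hermite raising_op_pderiv_quasi_hermite[OF assms] by simp

end
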